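(* A group $G$ contains a free subgroup of rank 2 if and only if there exist a subset $A$ of $G$ and elements $a,b,c$ in $G$ such that $G = A \cup aA$ and the sets $A$, $bA$, and $cA$ are pairwise disjoint.
   Context: For $g \in G$ and $A \subseteq G$, $gA = \{gx \mid x \in A\}$ denotes the left translate. *)

theory Defs
  imports "HOL-Algebra.Coset"
begin

text \<open>
  A word over \<open>S\<close> is a list of letters \<open>(s, e)\<close> with \<open>s \<in> S\<close>, where \<open>(s, True)\<close> stands for \<open>s\<close>
  and \<open>(s, False)\<close> for the formal inverse of \<open>s\<close>.
\<close>

definition reduced_words :: "'a set \<Rightarrow> ('a \<times> bool) list set" where
  "reduced_words S =
     {w \<in> lists (S \<times> UNIV). successively (\<lambda>(s, d) (t, e). \<not> (s = t \<and> d \<noteq> e)) w}"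

definition letter_value :: "('a, 'b) monoid_scheme \<Rightarrow> 'a \<times> bool \<Rightarrow> 'a" where
  "letter_value G = (\<lambda>(s, e). if e then s else inv\<^bsub>G\<^esub> s)"

definition word_value :: "('a, 'b) monoid_scheme \<Rightarrow> ('a \<times> bool) list \<Rightarrow> 'a" where
  "word_value G w = foldr (\<lambda>l x. letter_value G l \<otimes>\<^bsub>G\<^esub> x) w \<one>\<^bsub>G\<^esub>"

text \<open>
  \<open>S\<close> is a free basis of \<open>G\<close> if every element of \<open>G\<close> is the value of exactly one reduced word
  over \<open>S\<close>. Since the letters are formal, this also rules out \<open>\<one> \<in> S\<close> as well as distinct
  \<open>s, t \<in> S\<close> that are inverse to each other.
\<close>

definition free_basis :: "('a, 'b) monoid_scheme \<Rightarrow> 'a set \<Rightarrow> bool" where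
  "free_basis G S \<longleftrightarrow>
     S \<subseteq> carrier G \<and> bij_betw (word_value G) (reduced_words S) (carrier G)"

definition free_group_of_rank :: "('a, 'b) monoid_scheme \<Rightarrow> nat \<Rightarrow> bool" where
  "free_group_of_rank G n \<longleftrightarrow>
     group G \<and> (\<exists>S. finite S \<and> card S = n \<and> free_basis G S)"

end

theory Submission
  imports Defs
begin

text \<open>
  Let \<open>G = A \<union> aA\<close> with \<open>A\<close>, \<open>Y = bA\<close> and \<open>Z = cA\<close> pairwise disjoint. Both \<open>a\<close> and its inverse
  move the complement of \<open>A\<close> into \<open>A\<close>, so the conjugates \<open>y\<close> and \<open>z\<close> of \<open>a\<close> by \<open>b\<close> and \<open>c\<close>, and
  their inverses, move the complements of \<open>Y\<close> and \<open>Z\<close> into \<open>Y\<close> and \<open>Z\<close>. Hence \<open>ay\<close> and \<open>az\<close> play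
  ping-pong on the disjoint sets \<open>aY\<close>, \<open>Y\<close>, \<open>aZ\<close>, \<open>Z\<close>, and they freely generate a subgroup.

  Conversely, in a free group on \<open>p\<close> and \<open>q\<close> let \<open>A\<close> be the set of reduced words whose maximal
  initial power of \<open>p\<close> has odd exponent. Multiplication by \<open>p\<close> changes the parity, so
  \<open>A \<union> pA\<close> is everything, while the words of \<open>A\<close>, \<open>qA\<close> and \<open>q\<^sup>2A\<close> begin differently.
  A map \<open>r : G \<rightarrow> H\<close> with \<open>r (hg) = h r(g)\<close> pulls such a set back from a subgroup \<open>H\<close> to \<open>G\<close>.
\<close>

section \<open>Reduced words and their values\<close>

definition flip :: "'a \<times> bool \<Rightarrow> 'a \<times> bool" where
  "flip l = (fst l, \<not> snd l)"

lemma flip_in_letters [simp]: "flip l \<in> S \<times> UNIV \<longleftrightarrow> l \<in> S \<times> UNIV"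
  by (cases l) (simp add: flip_def)

lemma Nil_reduced [simp]: "[] \<in> reduced_words S"
  by (simp add: reduced_words_def)

text \<open>Via \<open>flip\<close>, the condition on two neighbouring letters becomes a single
  inequality, which is the form that inductions on reduced words use.\<close>

lemma Cons_reduced_iff:
  "l # w \<in> reduced_words S \<longleftrightarrow>
     l \<in> S \<times> UNIV \<and> w \<in> reduced_words S \<and> (w = [] \<or> hd w \<noteq> flip l)"
  by (cases l; cases "hd w") (auto simp: reduced_words_def successively_Cons flip_def)

lemma reduced_words_letters: "w \<in> reduced_words S \<Longrightarrow> w \<in> lists (S \<times> UNIV)"
  by (simp add: reduced_words_def)

lemma word_value_Nil [simp]: "word_value G [] = \<one>\<^bsub>G\<^esub>"
  by (simp add: word_value_def)

lemma word_value_Cons [simp]: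
  "word_value G (l # w) = letter_value G l \<otimes>\<^bsub>G\<^esub> word_value G w"
  by (simp add: word_value_def)

context group
begin

lemma letter_value_closed:
  "\<lbrakk>S \<subseteq> carrier G; l \<in> S \<times> UNIV\<rbrakk> \<Longrightarrow> letter_value G l \<in> carrier G"
  by (auto simp: letter_value_def)

lemma letter_value_flip:
  "\<lbrakk>S \<subseteq> carrier G; l \<in> S \<times> UNIV\<rbrakk> \<Longrightarrow> letter_value G (flip l) = inv (letter_value G l)"
  by (auto simp: letter_value_def flip_def)

lemma word_value_closed:
  assumes "S \<subseteq> carrier G" "w \<in> lists (S \<times> UNIV)"
  shows "word_value G w \<in> carrier G"
  using assms(2) by induction (auto intro: letter_value_closed[OF assms(1)])

lemma word_value_append:
  assumes S: "S \<subseteq> carrier G" and "v \<in> lists (S \<times> UNIV)" and w: "w \<in> lists (S \<times> UNIV)"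
  shows "word_value G (v @ w) = word_value G v \<otimes> word_value G w"
  using assms(2)
  by induction (simp_all add: word_value_closed[OF S] letter_value_closed[OF S] w m_assoc)

lemma word_value_inverse:
  assumes S: "S \<subseteq> carrier G" and "w \<in> lists (S \<times> UNIV)"
  shows "word_value G (rev (map flip w)) = inv (word_value G w)"
  using assms(2)
proof induction
  case (Cons l w)
  have "rev (map flip w) \<in> lists (S \<times> UNIV)"
    using Cons.hyps(2) by (auto simp: in_lists_conv_set)
  moreover have "[flip l] \<in> lists (S \<times> UNIV)"
    using Cons.hyps(1) by simp
  ultimately show ?case
    using Cons letter_value_closed[OF S, of "l"] word_value_closed[OF S, of w]
    by (simp add: word_value_append[OF S] letter_value_flip[OF S] inv_mult_group)
qed simp

text \<open>This is the reduced form of a letter times a reduced word: at most one cancellation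
  occurs, because the tail of a reduced word is itself reduced.\<close>

definition reduced_cons :: "'a \<times> bool \<Rightarrow> ('a \<times> bool) list \<Rightarrow> ('a \<times> bool) list" where
  "reduced_cons l w = (if w \<noteq> [] \<and> hd w = flip l then tl w else l # w)"

lemma reduced_cons_reduced:
  assumes "l \<in> S \<times> UNIV" "w \<in> reduced_words S"
  shows "reduced_cons l w \<in> reduced_words S"
  using assms by (cases w) (auto simp: reduced_cons_def Cons_reduced_iff)

lemma word_value_reduced_cons:
  assumes S: "S \<subseteq> carrier G" and l: "l \<in> S \<times> UNIV" and w: "w \<in> reduced_words S"
  shows "word_value G (reduced_cons l w) = letter_value G l \<otimes> word_value G w"
proof (cases "w \<noteq> [] \<and> hd w = flip l")
  case True
  then obtain v where v: "w = flip l # v" by (cases w) auto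
  have "v \<in> lists (S \<times> UNIV)"
    using reduced_words_letters[OF w] v by simp
  then show ?thesis
    using letter_value_closed[OF S l] word_value_closed[OF S]
    by (simp add: v reduced_cons_def letter_value_flip[OF S l] m_assoc[symmetric])
qed (auto simp: reduced_cons_def)

text \<open>Rebuilding a word from the right with \<open>reduced_cons\<close> cancels as it goes and
  keeps the value, so reduced words reach every product of letters.\<close>

lemma word_value_reduced_words:
  assumes S: "S \<subseteq> carrier G"
  shows "word_value G ` reduced_words S = word_value G ` lists (S \<times> UNIV)"
proof
  have "word_value G w \<in> word_value G ` reduced_words S" if "w \<in> lists (S \<times> UNIV)" for w
    using that
  proof induction
    case (Cons l w)
    then obtain v where "v \<in> reduced_words S" "word_value G w = word_value G v" by blast
    then show ?case
      using word_value_reduced_cons[OF S Cons.hyps(1)] reduced_cons_reduced[OF Cons.hyps(1)]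
      by (metis imageI word_value_Cons)
  qed (metis Nil_reduced imageI)
  then show "word_value G ` lists (S \<times> UNIV) \<subseteq> word_value G ` reduced_words S" by blast
qed (use reduced_words_letters in blast)

section \<open>The subgroup generated by a set\<close>

lemma subgroup_word_values:
  assumes S: "S \<subseteq> carrier G"
  shows "subgroup (word_value G ` lists (S \<times> UNIV)) G"
proof (rule subgroupI)
  show "word_value G ` lists (S \<times> UNIV) \<subseteq> carrier G"
    using word_value_closed[OF S] by blast
  show "word_value G ` lists (S \<times> UNIV) \<noteq> {}"
    by blast
next
  fix x assume "x \<in> word_value G ` lists (S \<times> UNIV)"
  then obtain w where w: "w \<in> lists (S \<times> UNIV)" "x = word_value G w" by blast
  moreover have "rev (map flip w) \<in> lists (S \<times> UNIV)"
    using w(1) by (auto simp: in_lists_conv_set)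
  ultimately show "inv x \<in> word_value G ` lists (S \<times> UNIV)"
    using word_value_inverse[OF S w(1)] by (metis imageI)
next
  fix x y assume "x \<in> word_value G ` lists (S \<times> UNIV)" "y \<in> word_value G ` lists (S \<times> UNIV)"
  then obtain v w where "v \<in> lists (S \<times> UNIV)" "x = word_value G v"
      "w \<in> lists (S \<times> UNIV)" "y = word_value G w" by blast
  then show "x \<otimes> y \<in> word_value G ` lists (S \<times> UNIV)"
    using word_value_append[OF S] by (metis append_in_lists_conv imageI)
qed

lemma word_value_subgroup:
  assumes H: "subgroup H G" and S: "S \<subseteq> H" and "w \<in> lists (S \<times> UNIV)"
  shows "word_value (G\<lparr>carrier := H\<rparr>) w = word_value G w"
  using assms(3)
proof induction
  case (Cons l w)
  have "letter_value (G\<lparr>carrier := H\<rparr>) l = letter_value G l"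
    using Cons.hyps(1) S m_inv_consistent[OF H] by (auto simp: letter_value_def)
  with Cons show ?case by simp
qed simp

text \<open>Surjectivity comes for free when \<open>H\<close> consists of the values of all words,
  so injectivity on reduced words is all that a freeness proof has to supply.\<close>

lemma free_group_of_rank_subgroup:
  assumes S: "S \<subseteq> carrier G" "finite S" and inj: "inj_on (word_value G) (reduced_words S)"
  shows "\<exists>H. subgroup H G \<and> free_group_of_rank (G\<lparr>carrier := H\<rparr>) (card S)"
proof -
  define H where "H = word_value G ` lists (S \<times> UNIV)"
  have H: "subgroup H G"
    unfolding H_def by (rule subgroup_word_values[OF S(1)])
  have "s \<in> H" if "s \<in> S" for s
  proof -
    have "word_value G [(s, True)] = s"
      using that S by (auto simp: letter_value_def)
    moreover have "[(s, True)] \<in> lists (S \<times> UNIV)"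
      using that by simp
    ultimately show ?thesis
      unfolding H_def by (metis imageI)
  qed
  then have SH: "S \<subseteq> H" by blast
  have "bij_betw (word_value G) (reduced_words S) H"
    using inj word_value_reduced_words[OF S(1)] by (simp add: bij_betw_def H_def)
  moreover have "word_value (G\<lparr>carrier := H\<rparr>) w = word_value G w" if "w \<in> reduced_words S" for w
    using word_value_subgroup[OF H SH reduced_words_letters[OF that]] .
  ultimately have "bij_betw (word_value (G\<lparr>carrier := H\<rparr>)) (reduced_words S) H"
    by (subst bij_betw_cong) auto
  then have "free_basis (G\<lparr>carrier := H\<rparr>) S"
    using SH by (simp add: free_basis_def)
  then show ?thesis
    using H S(2) subgroup.subgroup_is_group[OF H is_group] by (auto simp: free_group_of_rank_def)
qed

section \<open>The ping-pong argument\<close>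

text \<open>The letters act from right to left. Once a point lies in the set of the letter just
  applied, the next letter \<open>l\<close> may act: the word is reduced, so that set is not
  \<open>P (flip l)\<close> and is therefore disjoint from it. Only the last letter of the word
  needs a condition on \<open>x\<close>.\<close>

lemma ping_pong_word:
  assumes S: "S \<subseteq> carrier G"
    and disj: "\<And>l m. \<lbrakk>l \<in> S \<times> UNIV; m \<in> S \<times> UNIV; l \<noteq> m\<rbrakk> \<Longrightarrow> P l \<inter> P m = {}"
    and move: "\<And>l x. \<lbrakk>l \<in> S \<times> UNIV; x \<in> carrier G; x \<notin> P (flip l)\<rbrakk>
                 \<Longrightarrow> letter_value G l \<otimes> x \<in> P l"
    and w: "w \<in> reduced_words S" "w \<noteq> []"
    and x: "x \<in> carrier G" "x \<notin> P (flip (last w))"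
  shows "word_value G w \<otimes> x \<in> P (hd w)"
  using w x
proof (induction w)
  case (Cons l w)
  have l: "l \<in> S \<times> UNIV" and w: "w \<in> reduced_words S" and hd: "w = [] \<or> hd w \<noteq> flip l"
    using Cons.prems(1) unfolding Cons_reduced_iff by blast+
  note closed = letter_value_closed[OF S l] word_value_closed[OF S reduced_words_letters[OF w]]
  have *: "word_value G (l # w) \<otimes> x = letter_value G l \<otimes> (word_value G w \<otimes> x)"
    using closed Cons.prems(3) by (simp add: m_assoc)
  have "word_value G w \<otimes> x \<notin> P (flip l)"
  proof (cases "w = []")
    case True
    then show ?thesis using Cons.prems by simp
  next
    case False
    have "word_value G w \<otimes> x \<in> P (hd w)"
      using Cons.IH[OF w False] Cons.prems False by simp
    moreover have "hd w \<in> S \<times> UNIV"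
      using False reduced_words_letters[OF w] by (cases w) auto
    ultimately show ?thesis
      using disj[of "hd w" "flip l"] hd False l by auto
  qed
  then have "letter_value G l \<otimes> (word_value G w \<otimes> x) \<in> P l"
    using move[OF l] closed Cons.prems(3) by blast
  then show ?case
    unfolding * by simp
qed simp

text \<open>Words of equal value have the same first letter, since otherwise a suitable point would
  be sent into two disjoint sets. Cancelling that letter gives an induction. The sets may cover the
  whole group: test points are found inside them, chosen for each pair of words.\<close>

lemma ping_pong_inj:
  assumes S: "S \<subseteq> carrier G" and st: "s \<in> S" "t \<in> S" "s \<noteq> t"
    and P: "\<And>l. l \<in> S \<times> UNIV \<Longrightarrow> P l \<subseteq> carrier G"
    and ne: "\<And>l. l \<in> S \<times> UNIV \<Longrightarrow> P l \<noteq> {}"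
    and disj: "\<And>l m. \<lbrakk>l \<in> S \<times> UNIV; m \<in> S \<times> UNIV; l \<noteq> m\<rbrakk> \<Longrightarrow> P l \<inter> P m = {}"
    and move: "\<And>l x. \<lbrakk>l \<in> S \<times> UNIV; x \<in> carrier G; x \<notin> P (flip l)\<rbrakk>
                 \<Longrightarrow> letter_value G l \<otimes> x \<in> P l"
  shows "inj_on (word_value G) (reduced_words S)"
proof -
  \<comment> \<open>Of three distinct letters at least one differs from both \<open>l\<close> and
    \<open>m\<close>, and any point of its set avoids \<open>P l\<close> and
    \<open>P m\<close>.\<close>
  have avoid: "\<exists>x\<in>carrier G. x \<notin> P l \<and> x \<notin> P m"
    if "l \<in> S \<times> UNIV" "m \<in> S \<times> UNIV" for l m
  proof -
    obtain k where "k \<in> {(s, True), (s, False), (t, True)}" "k \<noteq> l" "k \<noteq> m"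
      using st(3) by (cases "l = (s, True)"; cases "m = (s, True)"; cases "l = (s, False)";
          cases "m = (s, False)") auto
    moreover from this have k: "k \<in> S \<times> UNIV" using st by auto
    moreover obtain x where "x \<in> P k" using ne[OF k] by blast
    ultimately show ?thesis
      using P[OF k] disj[OF k that(1)] disj[OF k that(2)] by blast
  qed
  have word: "word_value G w \<otimes> x \<in> P (hd w)"
    if "w \<in> reduced_words S" "w \<noteq> []" "x \<in> carrier G" "x \<notin> P (flip (last w))" for w x
    using S disj move that by (rule ping_pong_word)
  have letters: "hd w \<in> S \<times> UNIV" "last w \<in> S \<times> UNIV" if "w \<in> reduced_words S" "w \<noteq> []" for w
    using that reduced_words_letters[OF that(1)] by (auto simp: in_lists_conv_set)
  \<comment> \<open>A point outside \<open>P (hd w)\<close> is moved into \<open>P (hd w)\<close>,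
    so the word does not act as the identity.\<close>
  have nontriv: "word_value G w \<noteq> \<one>" if w: "w \<in> reduced_words S" "w \<noteq> []" for w
  proof
    assume 1: "word_value G w = \<one>"
    obtain x where x: "x \<in> carrier G" "x \<notin> P (hd w)" "x \<notin> P (flip (last w))"
      using avoid[of "hd w" "flip (last w)"] letters[OF w] by auto
    then show False
      using word[OF w x(1) x(3)] 1 by simp
  qed
  have "v = w" if "v \<in> reduced_words S" "w \<in> reduced_words S" "word_value G v = word_value G w"
    for v w
    using that
  proof (induction v arbitrary: w)
    case Nil
    then show ?case using nontriv by (metis word_value_Nil)
  next
    case (Cons l v)
    have "w \<noteq> []"
      using nontriv[OF Cons.prems(1)] Cons.prems(3) by auto
    then obtain m u where w: "w = m # u"
      by (cases w) auto
    have *: "l \<in> S \<times> UNIV" "v \<in> reduced_words S" "m \<in> S \<times> UNIV" "u \<in> reduced_words S"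
      using Cons.prems(1,2) unfolding w Cons_reduced_iff by blast+
    have "l = m"
    proof (rule ccontr)
      assume "l \<noteq> m"
      obtain x where x: "x \<in> carrier G" "x \<notin> P (flip (last (l # v)))" "x \<notin> P (flip (last w))"
        using avoid[of "flip (last (l # v))" "flip (last w)"] letters[OF Cons.prems(1)]
          letters[OF Cons.prems(2)] w by auto
      have "word_value G w \<otimes> x \<in> P l"
        using word[OF Cons.prems(1) _ x(1,2)] Cons.prems(3) by simp
      moreover have "word_value G w \<otimes> x \<in> P m"
        using word[OF Cons.prems(2) _ x(1,3)] by (simp add: w)
      ultimately show False
        using disj[OF *(1,3) \<open>l \<noteq> m\<close>] by blast
    qed
    have "word_value G v = word_value G u"
      using Cons.prems(3) letter_value_closed[OF S *(1)]
        word_value_closed[OF S reduced_words_letters[OF *(2)]]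
        word_value_closed[OF S reduced_words_letters[OF *(4)]]
      by (simp add: w \<open>l = m\<close>)
    then show ?case
      using Cons.IH[OF *(2,4)] by (simp add: w \<open>l = m\<close>)
  qed
  then show ?thesis by (rule inj_onI)
qed

lemma mem_l_coset_iff:
  assumes "A \<subseteq> carrier G" "g \<in> carrier G" "x \<in> carrier G"
  shows "x \<in> g <# A \<longleftrightarrow> inv g \<otimes> x \<in> A"
proof
  assume "x \<in> g <# A"
  then obtain u where "u \<in> A" "x = g \<otimes> u" by (auto simp: l_coset_def)
  with assms show "inv g \<otimes> x \<in> A" by (auto simp: m_assoc[symmetric])
next
  assume "inv g \<otimes> x \<in> A"
  moreover have "x = g \<otimes> (inv g \<otimes> x)" using assms by (simp add: m_assoc[symmetric])
  ultimately show "x \<in> g <# A" unfolding l_coset_def by blast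
qed

end

text \<open>The condition is stated for an arbitrary group structure so that it can be established
  in a subgroup and then transferred to \<open>G\<close>.\<close>

definition two_cover_three_disjoint ::
    "('a, 'b) monoid_scheme \<Rightarrow> 'a set \<Rightarrow> 'a \<Rightarrow> 'a \<Rightarrow> 'a \<Rightarrow> bool" where
  "two_cover_three_disjoint G A a b c \<longleftrightarrow>
     A \<subseteq> carrier G \<and> a \<in> carrier G \<and> b \<in> carrier G \<and> c \<in> carrier G \<and>
     carrier G = A \<union> (a <#\<^bsub>G\<^esub> A) \<and>
     A \<inter> (b <#\<^bsub>G\<^esub> A) = {} \<and>
     A \<inter> (c <#\<^bsub>G\<^esub> A) = {} \<and>
     (b <#\<^bsub>G\<^esub> A) \<inter> (c <#\<^bsub>G\<^esub> A) = {}"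

section \<open>From a decomposition to a free subgroup\<close>

context group
begin

text \<open>Let \<open>u\<close> lie outside \<open>A\<close>. Then \<open>u\<close> lies in
  \<open>aA\<close>, so \<open>inv a \<otimes> u\<close> is in \<open>A\<close>. If
  \<open>a \<otimes> u\<close> were outside \<open>A\<close>, it would lie in \<open>aA\<close>,
  forcing \<open>u\<close> into \<open>A\<close>. Translating by \<open>g\<close> gives the claim
  for the conjugates.\<close>

lemma conjugate_moves_complement:
  assumes A: "A \<subseteq> carrier G" and a: "a \<in> carrier G" and g: "g \<in> carrier G"
    and cover: "carrier G = A \<union> (a <# A)"
    and x: "x \<in> carrier G" "x \<notin> g <# A"
  shows "g \<otimes> a \<otimes> inv g \<otimes> x \<in> g <# A" "g \<otimes> inv a \<otimes> inv g \<otimes> x \<in> g <# A"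
proof -
  define u where "u = inv g \<otimes> x"
  have u: "u \<in> carrier G" "u \<notin> A"
    using x g mem_l_coset_iff[OF A g x(1)] by (simp_all add: u_def)
  have "a \<otimes> u \<in> carrier G" "inv a \<otimes> (a \<otimes> u) = u"
    using u a by (simp_all add: m_assoc[symmetric])
  then have "a \<otimes> u \<in> A"
    using cover u mem_l_coset_iff[OF A a, of "a \<otimes> u"] by auto
  moreover have "inv a \<otimes> u \<in> A"
    using cover u mem_l_coset_iff[OF A a u(1)] by blast
  moreover have "g \<otimes> a \<otimes> inv g \<otimes> x = g \<otimes> (a \<otimes> u)" "g \<otimes> inv a \<otimes> inv g \<otimes> x = g \<otimes> (inv a \<otimes> u)"
    using g a x by (simp_all add: u_def m_assoc)
  ultimately show "g \<otimes> a \<otimes> inv g \<otimes> x \<in> g <# A" "g \<otimes> inv a \<otimes> inv g \<otimes> x \<in> g <# A"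
    unfolding l_coset_def by auto
qed

text \<open>Both \<open>y\<close> and its inverse have the same target \<open>Y\<close>, which is
  useless for ping-pong. The extra factor \<open>a\<close> separates the targets:
  \<open>a \<otimes> y\<close> sends the complement of \<open>Y\<close> into \<open>aY\<close>, and
  its inverse sends the complement of \<open>aY\<close> into \<open>Y\<close>. The same holds for
  \<open>z\<close> and \<open>Z\<close>.\<close>

lemma free_subgroup_if_two_cover_three_disjoint:
  assumes "two_cover_three_disjoint G A a b c"
  shows "\<exists>H. subgroup H G \<and> free_group_of_rank (G\<lparr>carrier := H\<rparr>) 2"
proof -
  have A: "A \<subseteq> carrier G" and a: "a \<in> carrier G" and b: "b \<in> carrier G" and c: "c \<in> carrier G"
    and cover: "carrier G = A \<union> (a <# A)" and disj: "A \<inter> (b <# A) = {}" "A \<inter> (c <# A) = {}"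
      "(b <# A) \<inter> (c <# A) = {}"
    using assms unfolding two_cover_three_disjoint_def by blast+
  have "A \<noteq> {}"
    using cover one_closed by (auto simp: l_coset_def)
  then obtain u where u: "u \<in> A" by blast
  define Y Z where "Y = b <# A" and "Z = c <# A"
  define y z where "y = b \<otimes> a \<otimes> inv b" and "z = c \<otimes> a \<otimes> inv c"
  have Y: "Y \<subseteq> carrier G" and Z: "Z \<subseteq> carrier G"
    unfolding Y_def Z_def using A b c l_coset_subset_G by auto
  have yz: "y \<in> carrier G" "z \<in> carrier G"
    using a b c by (auto simp: y_def z_def)
  have inv_yz: "inv y = b \<otimes> inv a \<otimes> inv b" "inv z = c \<otimes> inv a \<otimes> inv c"
    using a b c by (simp_all add: y_def z_def inv_mult_group m_assoc)
  have y: "y \<otimes> x \<in> Y" "inv y \<otimes> x \<in> Y" if "x \<in> carrier G" "x \<notin> Y" for x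
    using conjugate_moves_complement[OF A a b cover] that unfolding inv_yz unfolding y_def Y_def
    by auto
  have z: "z \<otimes> x \<in> Z" "inv z \<otimes> x \<in> Z" if "x \<in> carrier G" "x \<notin> Z" for x
    using conjugate_moves_complement[OF A a c cover] that unfolding inv_yz unfolding z_def Z_def
    by auto
  \<comment> \<open>Applied to \<open>Y\<close> and \<open>Z\<close>, this puts \<open>aY\<close>
    and \<open>aZ\<close> inside \<open>A\<close>, hence away from \<open>Y\<close> and
    \<open>Z\<close>.\<close>
  have into_A: "a <# X \<subseteq> A" if "X \<subseteq> carrier G" "X \<inter> A = {}" for X
  proof
    fix x assume "x \<in> a <# X"
    then obtain u where u: "u \<in> X" "x = a \<otimes> u" by (auto simp: l_coset_def)
    then have "u \<in> carrier G" "u \<notin> A" using that by blast+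
    moreover from this have "x \<in> carrier G" "inv a \<otimes> x = u"
      using u a by (simp_all add: m_assoc[symmetric])
    ultimately show "x \<in> A"
      using cover mem_l_coset_iff[OF A a, of x] by auto
  qed
  define p q where "p = a \<otimes> y" and "q = a \<otimes> z"
  have pq: "p \<in> carrier G" "q \<in> carrier G" using a yz by (auto simp: p_def q_def)
  \<comment> \<open>If \<open>y = z\<close>, a point of \<open>A\<close>, which lies outside
    \<open>Y\<close> and \<open>Z\<close>, would be moved into both of these disjoint sets.\<close>
  have "p \<noteq> q"
  proof
    assume "p = q"
    then have "y = z" using a yz by (simp add: p_def q_def)
    moreover have "u \<in> carrier G" "u \<notin> Y" "u \<notin> Z" using u A disj by (auto simp: Y_def Z_def)
    ultimately show False using y(1)[of u] z(1)[of u] disj(3) by (auto simp: Y_def Z_def)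
  qed
  define P where "P = (\<lambda>(s, e). if e then a <# (if s = p then Y else Z) else (if s = p then Y else Z))"
  have P_simps: "P (p, True) = a <# Y" "P (p, False) = Y" "P (q, True) = a <# Z" "P (q, False) = Z"
    using \<open>p \<noteq> q\<close> by (simp_all add: P_def)
  have letters: "l \<in> {(p, True), (p, False), (q, True), (q, False)}" if "l \<in> {p, q} \<times> UNIV" for l
    using that by auto
  have "inj_on (word_value G) (reduced_words {p, q})"
  proof (rule ping_pong_inj[where P = P and s = p and t = q])
    show "P l \<subseteq> carrier G" if "l \<in> {p, q} \<times> UNIV" for l
      using letters[OF that] Y Z l_coset_subset_G[OF Y a] l_coset_subset_G[OF Z a]
      unfolding insert_iff by (elim disjE) (simp_all add: P_simps)
    show "P l \<noteq> {}" if "l \<in> {p, q} \<times> UNIV" for l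
      using letters[OF that] u by (auto simp: P_simps Y_def Z_def l_coset_def)
    have YA: "Y \<inter> A = {}" "Z \<inter> A = {}" "Y \<inter> Z = {}" "Z \<inter> Y = {}"
      using disj by (auto simp: Y_def Z_def)
    have aYZ: "(a <# Y) \<inter> (a <# Z) = {}"
      using YA(3) mem_l_coset_iff[OF Y a] mem_l_coset_iff[OF Z a] l_coset_subset_G[OF Y a]
      by blast
    show "P l \<inter> P m = {}" if "l \<in> {p, q} \<times> UNIV" "m \<in> {p, q} \<times> UNIV" "l \<noteq> m" for l m
      using letters[OF that(1)] letters[OF that(2)] that(3) YA aYZ into_A[OF Y YA(1)]
        into_A[OF Z YA(2)] unfolding insert_iff by (elim disjE) (simp_all add: P_simps, blast+)
    show "letter_value G l \<otimes> x \<in> P l"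
      if l: "l \<in> {p, q} \<times> UNIV" and x: "x \<in> carrier G" "x \<notin> P (flip l)" for l x
    proof -
      have neg: "inv a \<otimes> x \<notin> X" if "x \<notin> a <# X" "X \<subseteq> carrier G" for X
        using mem_l_coset_iff[OF that(2) a x(1)] that(1) by blast
      have pos: "a \<otimes> u \<in> a <# X" if "u \<in> X" for u X
        using that by (auto simp: l_coset_def)
      have "p \<otimes> x = a \<otimes> (y \<otimes> x)" "q \<otimes> x = a \<otimes> (z \<otimes> x)"
        "inv p \<otimes> x = inv y \<otimes> (inv a \<otimes> x)" "inv q \<otimes> x = inv z \<otimes> (inv a \<otimes> x)"
        using a yz x(1) by (simp_all add: p_def q_def inv_mult_group m_assoc)
      then show ?thesis
        using letters[OF l] x y z a neg[OF _ Y] neg[OF _ Z] pos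
        by (auto simp: P_simps flip_def letter_value_def)
    qed
  qed (use pq \<open>p \<noteq> q\<close> in auto)
  then show ?thesis
    using free_group_of_rank_subgroup[of "{p, q}"] pq \<open>p \<noteq> q\<close> by (simp add: numeral_2_eq_2)
qed

section \<open>From a free basis to a decomposition\<close>

text \<open>Words in \<open>W\<close> begin with \<open>p\<close> or its inverse, those for
  \<open>qA\<close> with one \<open>q\<close> followed by such a letter, and those for the third set
  with \<open>q\<close> twice. All of them are reduced, so uniqueness of reduced words separates the
  three sets.\<close>

lemma two_cover_three_disjoint_if_free_basis:
  assumes basis: "free_basis G S" and pq: "p \<in> S" "q \<in> S" "p \<noteq> q"
  shows "\<exists>A. two_cover_three_disjoint G A p q (q \<otimes> q)"
proof -
  \<comment> \<open>The run counts \<open>p\<close> and its inverse alike. In a reduced word it has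
    only one sign, so its length is the absolute value of the exponent. A missing run has length 0
    and counts as even.\<close>
  define odd_run where "odd_run w \<longleftrightarrow> odd (length (takeWhile (\<lambda>l. fst l = p) w))"
    for w :: "('a \<times> bool) list"
  define W where "W = {w \<in> reduced_words S. odd_run w}"
  define A where "A = word_value G ` W"
  have S: "S \<subseteq> carrier G" and bij: "bij_betw (word_value G) (reduced_words S) (carrier G)"
    using basis by (auto simp: free_basis_def)
  have W: "W \<subseteq> reduced_words S" by (auto simp: W_def)
  have A: "A \<subseteq> carrier G"
    using bij W by (auto simp: A_def bij_betw_def)
  have pqG: "p \<in> carrier G" "q \<in> carrier G" using S pq by auto
  \<comment> \<open>A new letter over \<open>p\<close> either cancels the first letter of the run or
    extends the run, so the length changes by exactly one.\<close>
  have flips: "odd_run (reduced_cons (p, e) w) \<longleftrightarrow> \<not> odd_run w" for e w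
    by (cases w) (auto simp: odd_run_def reduced_cons_def flip_def)
  have cover: "carrier G = A \<union> (p <# A)"
  proof
    show "A \<union> (p <# A) \<subseteq> carrier G" using A l_coset_subset_G[OF A pqG(1)] by blast
    show "carrier G \<subseteq> A \<union> (p <# A)"
    proof
      fix x assume x: "x \<in> carrier G"
      then obtain w where w: "w \<in> reduced_words S" "x = word_value G w"
        using bij by (auto simp: bij_betw_def)
      show "x \<in> A \<union> (p <# A)"
      proof (cases "odd_run w")
        case True
        then show ?thesis using w by (auto simp: A_def W_def)
      next
        case False
        \<comment> \<open>If the run of \<open>x\<close> is even, that of
          \<open>inv p \<otimes> x\<close> is odd, which puts \<open>x\<close> in
          \<open>pA\<close>.\<close>
        let ?v = "reduced_cons (p, False) w"
        have l: "(p, False) \<in> S \<times> UNIV" using pq by simp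
        have "?v \<in> W"
          using reduced_cons_reduced[OF l w(1)] False by (simp add: W_def flips)
        then have "word_value G ?v \<in> A" by (simp add: A_def)
        moreover have "word_value G ?v = inv p \<otimes> x"
          using word_value_reduced_cons[OF S l w(1)] w(2) by (simp add: letter_value_def)
        ultimately show ?thesis
          using mem_l_coset_iff[OF A pqG(1) x] by simp
      qed
    qed
  qed
  \<comment> \<open>An odd run is nonempty, so a \<open>q\<close> placed in front of
    \<open>w\<close> cannot cancel.\<close>
  have hd_W: "w \<noteq> [] \<and> fst (hd w) = p" if "w \<in> W" for w
    using that by (cases w) (auto simp: W_def odd_run_def split: if_splits)
  have Q1: "Cons (q, True) ` W \<subseteq> reduced_words S"
  proof (rule image_subsetI)
    fix w assume w: "w \<in> W"
    then have "hd w \<noteq> flip (q, True)" using hd_W[OF w] pq(3) by (auto simp: flip_def)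
    then show "(q, True) # w \<in> reduced_words S"
      using w W pq(2) by (auto simp: Cons_reduced_iff)
  qed
  then have Q2: "(\<lambda>w. (q, True) # (q, True) # w) ` W \<subseteq> reduced_words S"
    using pq by (auto simp: Cons_reduced_iff flip_def)
  have closed: "word_value G w \<in> carrier G" if "w \<in> W" for w
    using that W bij by (auto simp: bij_betw_def)
  have qA: "q <# A = word_value G ` Cons (q, True) ` W"
    by (auto simp: l_coset_def A_def image_image letter_value_def)
  have "q \<otimes> q \<otimes> word_value G w = q \<otimes> (q \<otimes> word_value G w)" if "w \<in> W" for w
    using closed[OF that] pqG by (simp add: m_assoc)
  then have qqA: "(q \<otimes> q) <# A = word_value G ` (\<lambda>w. (q, True) # (q, True) # w) ` W"
    by (auto simp: l_coset_def A_def image_image letter_value_def)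
  have disjoint: "word_value G ` U \<inter> word_value G ` V = {}"
    if "U \<subseteq> reduced_words S" "V \<subseteq> reduced_words S" "U \<inter> V = {}" for U V
    using inj_on_image_Int[OF bij_betw_imp_inj_on[OF bij] that(1,2)] that(3) by simp
  have not_W: "(q, e) # w \<notin> W" for e w
    using hd_W[of "(q, e) # w"] pq(3) by auto
  have "A \<inter> (q <# A) = {}"
    unfolding qA unfolding A_def by (rule disjoint[OF W Q1]) (auto simp: not_W)
  moreover have "A \<inter> ((q \<otimes> q) <# A) = {}"
    unfolding qqA unfolding A_def by (rule disjoint[OF W Q2]) (auto simp: not_W)
  moreover have "(q <# A) \<inter> ((q \<otimes> q) <# A) = {}"
    unfolding qqA qA by (rule disjoint[OF Q1 Q2]) (auto simp: not_W)
  ultimately show ?thesis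
    using cover A pqG unfolding two_cover_three_disjoint_def by blast
qed

section \<open>Transfer from a subgroup to the whole group\<close>

text \<open>Choose a representative of each right coset of \<open>H\<close> and let
  \<open>r g\<close> be the factor in \<open>H\<close> that takes the representative of
  \<open>H #> g\<close> to \<open>g\<close>. Left multiplication by \<open>h\<close> keeps the coset
  and its representative, so it only multiplies this factor by \<open>h\<close>.\<close>

lemma subgroup_equivariant_map:
  assumes H: "subgroup H G"
  shows "\<exists>r. \<forall>g\<in>carrier G. r g \<in> H \<and> (\<forall>h\<in>H. r (h \<otimes> g) = h \<otimes> r g)"
proof -
  define rep where "rep C = (SOME x. x \<in> C)" for C :: "'a set"
  define r where "r g = g \<otimes> inv (rep (H #> g))" for g
  have HG: "H \<subseteq> carrier G" using subgroup.subset[OF H] .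
  have rep: "\<exists>h\<in>H. rep (H #> g) = h \<otimes> g" if "g \<in> carrier G" for g
  proof -
    have "rep (H #> g) \<in> H #> g"
      unfolding rep_def by (rule someI_ex) (use rcos_self[OF that H] in blast)
    then show ?thesis by (auto simp: r_coset_def)
  qed
  have "r g \<in> H" if g: "g \<in> carrier G" for g
  proof -
    obtain h where h: "h \<in> H" "rep (H #> g) = h \<otimes> g" using rep[OF g] by blast
    have "h \<in> carrier G" using h HG by blast
    then have "r g = inv h"
      using g by (simp add: r_def h inv_mult_group m_assoc[symmetric])
    then show ?thesis using subgroup.m_inv_closed[OF H h(1)] by simp
  qed
  moreover have "r (h \<otimes> g) = h \<otimes> r g" if g: "g \<in> carrier G" and h: "h \<in> H" for g h
  proof -
    have hG: "h \<in> carrier G" using h HG by blast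
    have "H #> (h \<otimes> g) = H #> g"
      using coset_mult_assoc[OF HG hG g] coset_join2[OF hG H h] by simp
    moreover have "rep (H #> g) \<in> carrier G"
      using rep[OF g] g HG by auto
    ultimately show ?thesis
      using g hG by (simp add: r_def m_assoc)
  qed
  ultimately show ?thesis by blast
qed

text \<open>Take for \<open>B\<close> the preimage of \<open>A\<close> under an equivariant map to
  \<open>H\<close>. For \<open>h\<close> in \<open>H\<close>, the translate \<open>hB\<close> is
  then the preimage of \<open>hA\<close>, and preimages preserve covers and disjointness.\<close>

lemma two_cover_three_disjoint_of_subgroup:
  assumes H: "subgroup H G" and dec: "two_cover_three_disjoint (G\<lparr>carrier := H\<rparr>) A a b c"
  shows "\<exists>B. two_cover_three_disjoint G B a b c"
proof -
  obtain r where r: "\<And>g. g \<in> carrier G \<Longrightarrow> r g \<in> H"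
      "\<And>g h. \<lbrakk>g \<in> carrier G; h \<in> H\<rbrakk> \<Longrightarrow> r (h \<otimes> g) = h \<otimes> r g"
    using subgroup_equivariant_map[OF H] by blast
  have HG: "H \<subseteq> carrier G" using subgroup.subset[OF H] .
  have K: "carrier (G\<lparr>carrier := H\<rparr>) = H" "x <#\<^bsub>G\<lparr>carrier := H\<rparr>\<^esub> A = x <# A" for x
    by (simp_all add: l_coset_def)
  have A: "A \<subseteq> H" and abc: "a \<in> H" "b \<in> H" "c \<in> H" and cover: "H = A \<union> (a <# A)"
    and disj: "A \<inter> (b <# A) = {}" "A \<inter> (c <# A) = {}" "(b <# A) \<inter> (c <# A) = {}"
    using dec unfolding two_cover_three_disjoint_def K by - (elim conjE, assumption)+
  define B where "B = {g \<in> carrier G. r g \<in> A}"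
  have B: "B \<subseteq> carrier G" by (auto simp: B_def)
  have iff: "x \<in> h <# B \<longleftrightarrow> r x \<in> h <# A" if h: "h \<in> H" and x: "x \<in> carrier G" for h x
  proof -
    have hG: "h \<in> carrier G" using h HG by blast
    have "x \<in> h <# B \<longleftrightarrow> inv h \<otimes> r x \<in> A"
      using mem_l_coset_iff[OF B hG x] r(2)[OF x subgroup.m_inv_closed[OF H h]] x hG
      by (simp add: B_def)
    also have "\<dots> \<longleftrightarrow> r x \<in> h <# A"
      using mem_l_coset_iff[OF _ hG, of A "r x"] A HG r(1)[OF x] by blast
    finally show ?thesis .
  qed
  have sub: "h <# B \<subseteq> carrier G" if "h \<in> H" for h
    using l_coset_subset_G[OF B] that HG by blast
  have "carrier G = B \<union> (a <# B)"
    using sub[OF abc(1)] iff[OF abc(1)] r(1) cover by (auto simp: B_def)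
  moreover have "B \<inter> (b <# B) = {}" "B \<inter> (c <# B) = {}"
    using iff[OF abc(2)] iff[OF abc(3)] disj by (auto simp: B_def)
  moreover have "(b <# B) \<inter> (c <# B) = {}"
    using iff[OF abc(2)] iff[OF abc(3)] sub[OF abc(2)] disj(3) by blast
  moreover have "a \<in> carrier G" "b \<in> carrier G" "c \<in> carrier G"
    using abc HG by auto
  ultimately have "two_cover_three_disjoint G B a b c"
    using B unfolding two_cover_three_disjoint_def by (intro conjI)
  then show ?thesis ..
qed

end

theorem corollary1:
  fixes G :: "('a, 'b) monoid_scheme"
  assumes "group G"
  shows "(\<exists>H. subgroup H G \<and> free_group_of_rank (G\<lparr>carrier := H\<rparr>) 2) \<longleftrightarrow>
    (\<exists>A a b c. A \<subseteq> carrier G \<and> a \<in> carrier G \<and> b \<in> carrier G \<and> c \<in> carrier G \<and>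
       carrier G = A \<union> (a <#\<^bsub>G\<^esub> A) \<and>
       A \<inter> (b <#\<^bsub>G\<^esub> A) = {} \<and>
       A \<inter> (c <#\<^bsub>G\<^esub> A) = {} \<and>
       (b <#\<^bsub>G\<^esub> A) \<inter> (c <#\<^bsub>G\<^esub> A) = {})"
  unfolding two_cover_three_disjoint_def[symmetric]
proof
  interpret group G by fact
  assume "\<exists>H. subgroup H G \<and> free_group_of_rank (G\<lparr>carrier := H\<rparr>) 2"
  then obtain H S where H: "subgroup H G" and K: "group (G\<lparr>carrier := H\<rparr>)"
    and S: "card S = 2" "free_basis (G\<lparr>carrier := H\<rparr>) S"
    by (auto simp: free_group_of_rank_def)
  \<comment> \<open>The decomposition is built inside \<open>H\<close> from its two basis elements
    and pulled back to \<open>G\<close> with the same translating elements.\<close>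
  obtain p q where "p \<in> S" "q \<in> S" "p \<noteq> q"
    using S(1) by (auto simp: card_2_iff)
  then show "\<exists>A a b c. two_cover_three_disjoint G A a b c"
    using group.two_cover_three_disjoint_if_free_basis[OF K S(2)]
      two_cover_three_disjoint_of_subgroup[OF H] by blast
next
  assume "\<exists>A a b c. two_cover_three_disjoint G A a b c"
  then show "\<exists>H. subgroup H G \<and> free_group_of_rank (G\<lparr>carrier := H\<rparr>) 2"
    using group.free_subgroup_if_two_cover_three_disjoint[OF assms] by blast
qed

end
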